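(* Let $G=(V,E,\omega,\mu)$ be a graph with $\mu_{\min}>0$ and $D_\mu<\infty$. Assume $p,q>0$ and $pq>1$. For any given functions $u_0,v_0:V\to\mathbb R$ that are nonnegative and bounded on $V$, there exists $T$ with $0<T<+\infty$ such that the system $$\begin{cases}u_t=\Delta u+v^p, & v_t=\Delta v+u^q,\\ u(0,x)=u_0(x), & v(0,x)=v_0(x),\quad x\in V,\end{cases}$$ admits a nonnegative solution $(u,v)$ for $t\in[0,T]$.
   Context: Graphs: $G=(V,E,\omega,\mu)$ is an infinite, locally finite, connected graph without loops or multiple edges; $\omega:V\times V\to[0,\infty)$ is symmetric with $\omega_{xy}>0$ iff $x\sim y$; $\mu:V\to(0,\infty)$; $\mu_{\min}=\inf_V\mu$; $D_\mu=\sup_{x\in V}\frac1{\mu(x)}\sum_{y\sim x}\omega_{xy}$. The Laplacian is $\Delta f(x)=\frac1{\mu(x)}\sum_{y\sim x}\omega_{xy}(f(y)-f(x))$. $\ell^\infty(V)$ is the space of bounded real functions on $V$ with the sup norm, and $C([0,T];\ell^\infty(V))$ is the space of continuous maps $[0,T]\to\ell^\infty(V)$ for the norm topology. A pair $(u,v)$ of functions on $[0,T]\times V$ is a solution of the system in $[0,T]$ if $u,v\in C([0,T];\ell^\infty(V))$, the equations $u_t=\Delta u+v^p$ and $v_t=\Delta v+u^q$ hold for every $t\in[0,T]$ and $x\in V$ (one-sided time derivatives at the endpoints), and $u(0,\cdot)=u_0$, $v(0,\cdot)=v_0$. *)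

theory Defs
  imports "HOL-Analysis.Analysis"
begin

text \<open>
  The vertex set is the whole type \<open>'v\<close>. An undirected edge set without loops or multiple
  edges is an irreflexive symmetric adjacency relation \<open>adj\<close>.
\<close>

locale weighted_graph =
  fixes adj :: "'v \<Rightarrow> 'v \<Rightarrow> bool"
    and \<omega> :: "'v \<Rightarrow> 'v \<Rightarrow> real"
    and \<mu> :: "'v \<Rightarrow> real"
  assumes infinite_vertices: "infinite (UNIV :: 'v set)"
    and adj_sym: "adj x y \<Longrightarrow> adj y x"
    and adj_irrefl: "\<not> adj x x"
    and locally_finite: "finite {y. adj x y}"
    and connected_graph: "adj\<^sup>*\<^sup>* x y"
    and weight_nonneg: "0 \<le> \<omega> x y"
    and weight_sym: "\<omega> x y = \<omega> y x"
    and weight_pos_iff: "0 < \<omega> x y \<longleftrightarrow> adj x y"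
    and measure_pos: "0 < \<mu> x"

definition mu_min :: "('v \<Rightarrow> real) \<Rightarrow> real" where
  "mu_min \<mu> = (INF x. \<mu> x)"

text \<open>Extended-real valued, since the supremum may be infinite.\<close>

definition D_mu :: "('v \<Rightarrow> 'v \<Rightarrow> bool) \<Rightarrow> ('v \<Rightarrow> 'v \<Rightarrow> real) \<Rightarrow> ('v \<Rightarrow> real) \<Rightarrow> ereal" where
  "D_mu adj \<omega> \<mu> = (SUP x. ereal (1 / \<mu> x * (\<Sum>y | adj x y. \<omega> x y)))"

definition laplacian ::
  "('v \<Rightarrow> 'v \<Rightarrow> bool) \<Rightarrow> ('v \<Rightarrow> 'v \<Rightarrow> real) \<Rightarrow> ('v \<Rightarrow> real) \<Rightarrow> ('v \<Rightarrow> real) \<Rightarrow> 'v \<Rightarrow> real" where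
  "laplacian adj \<omega> \<mu> f x = 1 / \<mu> x * (\<Sum>y | adj x y. \<omega> x y * (f y - f x))"

text \<open>
  \<^const>\<open>funspace\<close> over \<^const>\<open>euclidean_metric\<close> consists of the bounded functions, with
  distance \<open>SUP x. \<bar>f x - g x\<bar>\<close>.
\<close>

definition ell_infinity :: "('v \<Rightarrow> real) metric" where
  "ell_infinity = funspace UNIV euclidean_metric"

definition C_ell_infinity :: "real \<Rightarrow> (real \<Rightarrow> 'v \<Rightarrow> real) set" where
  "C_ell_infinity T = {u. continuous_map (top_of_set {0..T}) (mtopology_of ell_infinity) u}"

text \<open>
  Functions on \<open>[0,T] \<times> V\<close> are functions of type \<^typ>\<open>real \<Rightarrow> 'v \<Rightarrow> real\<close> whose values at times
  outside \<open>[0,T]\<close> are irrelevant; derivatives within \<open>{0..T}\<close> are one-sided at the endpoints.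
  The nonlinearities have their usual meaning where \<open>u\<close> and \<open>v\<close> are nonnegative
  (\<open>0 powr p = 0\<close>).
\<close>

definition is_solution ::
  "('v \<Rightarrow> 'v \<Rightarrow> bool) \<Rightarrow> ('v \<Rightarrow> 'v \<Rightarrow> real) \<Rightarrow> ('v \<Rightarrow> real) \<Rightarrow> real \<Rightarrow> real \<Rightarrow>
   ('v \<Rightarrow> real) \<Rightarrow> ('v \<Rightarrow> real) \<Rightarrow> real \<Rightarrow>
   (real \<Rightarrow> 'v \<Rightarrow> real) \<Rightarrow> (real \<Rightarrow> 'v \<Rightarrow> real) \<Rightarrow> bool" where
  "is_solution adj \<omega> \<mu> p q u0 v0 T u v \<longleftrightarrow>
     u \<in> C_ell_infinity T \<and> v \<in> C_ell_infinity T \<and>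
     (\<forall>t\<in>{0..T}. \<forall>x.
        ((\<lambda>s. u s x) has_real_derivative laplacian adj \<omega> \<mu> (u t) x + v t x powr p)
          (at t within {0..T}) \<and>
        ((\<lambda>s. v s x) has_real_derivative laplacian adj \<omega> \<mu> (v t) x + u t x powr q)
          (at t within {0..T})) \<and>
     (\<forall>x. u 0 x = u0 x) \<and> (\<forall>x. v 0 x = v0 x)"

end

theory Submission
  imports Defs
begin

text \<open>
  Since \<open>p\<close> or \<open>q\<close> may be less than \<open>1\<close>, the nonlinearity need not be Lipschitz and Picard
  contraction fails. Instead one iterates monotonically. If \<open>D \<ge> D\<^sub>\<mu>\<close>, then \<open>f \<mapsto> \<Delta>f + D f\<close>
  preserves order, so in the integrated form
  \<open>w(t) = e\<^bsup>-Dt\<^esup> (w\<^sub>0 + \<integral>\<^sub>0\<^sup>t e\<^bsup>Ds\<^esup> (D w + H w)(s) ds)\<close> of the system \<open>w' = H w\<close> the right-hand side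
  is increasing in \<open>w\<close>. On a short time interval it maps functions with values in \<open>[0,M]\<close> to such
  functions, so its iterates from \<open>0\<close> increase to a fixed point by dominated convergence. Local
  finiteness makes each component of \<open>H\<close> continuous for pointwise convergence, and the uniform bound
  on \<open>H w\<close> makes the solution Lipschitz in time with values in \<open>\<ell>\<^sup>\<infinity>\<close>.
\<close>

lemma quasimonotone_system_solution:
  fixes H :: "('i \<Rightarrow> real) \<Rightarrow> 'i \<Rightarrow> real" and w0 :: "'i \<Rightarrow> real"
  defines "B \<equiv> \<lambda>M. {w. \<forall>j. w j \<in> {0..M}}"
  assumes cont: "\<And>i. continuous_on (B M) (\<lambda>w. H w i)"
    and mono: "\<And>w w' i. \<lbrakk>w \<in> B M; w' \<in> B M; w \<le> w'\<rbrakk> \<Longrightarrow> D * w i + H w i \<le> D * w' i + H w' i"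
    and zero: "\<And>i. 0 \<le> H (\<lambda>_. 0) i"
    and bound: "\<And>w i. w \<in> B M \<Longrightarrow> \<bar>H w i\<bar> \<le> K"
    and nonneg: "0 \<le> D" "0 \<le> M" "0 \<le> K" "0 \<le> T"
    and w0: "\<And>i. 0 \<le> w0 i" "\<And>i. w0 i + T * (D * M + K) \<le> M"
  obtains w where "\<And>t i. t \<in> {0..T} \<Longrightarrow> w t i \<in> {0..M}"
    and "\<And>i. w 0 i = w0 i"
    and "\<And>t i. t \<in> {0..T} \<Longrightarrow> ((\<lambda>s. w s i) has_real_derivative H (w t) i) (at t within {0..T})"
    and "\<And>s t i. \<lbrakk>s \<in> {0..T}; t \<in> {0..T}\<rbrakk> \<Longrightarrow> \<bar>w s i - w t i\<bar> \<le> K * \<bar>s - t\<bar>"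
proof -
  \<comment> \<open>Integrating factor: along a solution of \<open>w' = H w\<close>, this is the
    time derivative of \<open>exp (D * s) * w s i\<close>. The added \<open>D * w s i\<close> makes
    the integrand order preserving.\<close>
  define g where "g w s i = exp (D * s) * (D * w s i + H (w s) i)" for w :: "real \<Rightarrow> 'i \<Rightarrow> real" and s i
  define F where "F w t i = exp (- (D * t)) * (w0 i + integral {0..t} (\<lambda>s. g w s i))" for w t i
  define W where "W n = (F ^^ n) (\<lambda>_ _. 0)" for n
  have W0: "W 0 = (\<lambda>_ _. 0)" and W_Suc: "W (Suc n) = F (W n)" for n
    by (simp_all add: W_def)
  have zB: "(\<lambda>_. 0) \<in> B M" using nonneg by (simp add: B_def)

  \<comment> \<open>Bounds and continuity for the integral operator\<close>
  have bracket: "0 \<le> D * w i + H w i" "D * w i + H w i \<le> D * M + K" if "w \<in> B M" for w i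
  proof -
    \<comment> \<open>By \<open>mono\<close>, the value at \<open>w\<close> dominates the value at
      the zero function, which is \<open>H (\<lambda>_. 0) i\<close> and hence nonnegative.\<close>
    show "0 \<le> D * w i + H w i"
      using mono[OF zB that, of i] zero[of i] that by (auto simp: B_def le_fun_def)
    have "D * w i \<le> D * M" using that nonneg by (intro mult_left_mono) (auto simp: B_def)
    with bound[OF that, of i] show "D * w i + H w i \<le> D * M + K" by linarith
  qed
  have g_bounds: "0 \<le> g w s i" "g w s i \<le> exp (D * s) * (D * M + K)" if "w s \<in> B M" for w s i
    using bracket[OF that, of i] by (simp_all add: g_def)
  have g_cont: "continuous_on {0..T} (\<lambda>s. g w s i)"
    if c: "continuous_on {0..T} w" and b: "\<And>s. s \<in> {0..T} \<Longrightarrow> w s \<in> B M" for w i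
  proof -
    have "continuous_on {0..T} (\<lambda>s. H (w s) i)"
      using continuous_on_compose2[OF cont c] b by blast
    moreover have "continuous_on {0..T} (\<lambda>s. w s i)"
      by (rule continuous_on_product_then_coordinatewise[OF c])
    ultimately show ?thesis unfolding g_def by (intro continuous_intros)
  qed
  \<comment> \<open>Only integrability is assumed, so that this also applies to the limit of the
    iterates before its continuity in time is known.\<close>
  have F_cont: "continuous_on {0..T} (F w)"
    if "\<And>i. (\<lambda>s. g w s i) integrable_on {0..T}" for w
  proof (rule continuous_on_coordinatewise_then_product)
    fix i show "continuous_on {0..T} (\<lambda>t. F w t i)"
      unfolding F_def by (intro continuous_intros indefinite_integral_continuous_1 that)
  qed
  have F_box: "F w t \<in> B M"
    if int: "\<And>i. (\<lambda>s. g w s i) integrable_on {0..T}" and b: "\<And>s. s \<in> {0..T} \<Longrightarrow> w s \<in> B M"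
      and t: "t \<in> {0..T}" for w t
  proof -
    have "F w t i \<in> {0..M}" for i
    proof -
      have sub: "{0..t} \<subseteq> {0..T}" using t by auto
      have int_t: "(\<lambda>s. g w s i) integrable_on {0..t}"
        using integrable_on_subinterval[OF int sub] .
      have lo: "0 \<le> integral {0..t} (\<lambda>s. g w s i)"
        using sub b g_bounds(1) by (intro integral_nonneg int_t) blast
      \<comment> \<open>Replacing \<open>exp (D * s)\<close> by its largest value lets it cancel
        against the outer factor \<open>exp (- (D * t))\<close>, leaving growth at most
        \<open>t * (D * M + K)\<close>.\<close>
      have "g w s i \<le> exp (D * t) * (D * M + K)" if "s \<in> {0..t}" for s
      proof -
        have "g w s i \<le> exp (D * s) * (D * M + K)" using g_bounds(2) b sub that by blast
        also have "\<dots> \<le> exp (D * t) * (D * M + K)"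
          using that nonneg by (intro mult_right_mono) (auto intro!: mult_left_mono)
        finally show ?thesis .
      qed
      then have "integral {0..t} (\<lambda>s. g w s i) \<le> integral {0..t} (\<lambda>s. exp (D * t) * (D * M + K))"
        by (intro integral_le int_t integrable_const_ivl) auto
      then have hi: "integral {0..t} (\<lambda>s. g w s i) \<le> t * (exp (D * t) * (D * M + K))"
        using t by (simp add: mult.left_commute)
      have "F w t i \<le> exp (- (D * t)) * (w0 i + t * (exp (D * t) * (D * M + K)))"
        unfolding F_def using hi by (intro mult_left_mono) auto
      also have "\<dots> = exp (- (D * t)) * w0 i + t * (D * M + K)"
        by (simp add: algebra_simps exp_minus)
      also have "\<dots> \<le> 1 * w0 i + T * (D * M + K)"
        using t nonneg w0(1)[of i] by (intro add_mono mult_right_mono) auto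
      also have "\<dots> \<le> M" using w0(2) by simp
      finally show ?thesis using lo w0(1)[of i] by (simp add: F_def)
    qed
    then show ?thesis by (simp add: B_def)
  qed

  \<comment> \<open>Monotone iteration from zero\<close>
  have W_inv: "continuous_on {0..T} (W n) \<and> (\<forall>s\<in>{0..T}. W n s \<in> B M)" for n
  proof (induction n)
    case 0
    show ?case using zB by (simp add: W0)
  next
    case (Suc n)
    then have "(\<lambda>s. g (W n) s i) integrable_on {0..T}" for i
      by (intro integrable_continuous_real g_cont) auto
    then show ?case using F_cont F_box Suc by (simp add: W_Suc)
  qed
  then have W_box: "W n s \<in> B M" if "s \<in> {0..T}" for n s using that by blast
  have gW_int: "(\<lambda>s. g (W n) s i) integrable_on {0..t}" if "t \<in> {0..T}" for n i t
    using W_inv[of n] that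
    by (intro integrable_continuous_real continuous_on_subset[OF g_cont]) auto
  have W_mono: "\<forall>t\<in>{0..T}. W n t \<le> W (Suc n) t" for n
  proof (induction n)
    case 0
    \<comment> \<open>The iteration starts at the least element of the box \<open>B M\<close>, so
      the first step can only go up.\<close>
    show ?case using W_box[of _ "Suc 0"] by (auto simp: W0 B_def le_fun_def)
  next
    case (Suc n)
    have "F (W n) t i \<le> F (W (Suc n)) t i" if t: "t \<in> {0..T}" for t i
    proof -
      have "g (W n) s i \<le> g (W (Suc n)) s i" if "s \<in> {0..t}" for s
        unfolding g_def using that t Suc by (intro mult_left_mono mono W_box) auto
      then have "integral {0..t} (\<lambda>s. g (W n) s i) \<le> integral {0..t} (\<lambda>s. g (W (Suc n)) s i)"
        by (intro integral_le gW_int t)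
      then show ?thesis by (simp add: F_def)
    qed
    then show ?case by (simp add: W_Suc le_fun_def)
  qed

  \<comment> \<open>Passage to the limit\<close>
  define w where "w t i = lim (\<lambda>n. W n t i)" for t i
  have W_lim: "(\<lambda>n. W n t i) \<longlonglongrightarrow> w t i" if t: "t \<in> {0..T}" for t i
  proof -
    have "incseq (\<lambda>n. W n t i)"
      using W_mono t by (intro incseq_SucI) (auto simp: le_fun_def)
    moreover have "W n t i \<le> M" for n using W_box[OF t, of n] by (auto simp: B_def)
    ultimately show ?thesis
      unfolding w_def by (metis convergent_LIMSEQ_iff incseq_convergent convergentI)
  qed
  have w_box: "w t \<in> B M" if t: "t \<in> {0..T}" for t
  proof -
    have "w t i \<in> {0..M}" for i
      using W_box[OF t]
      by (intro closed_sequentially[OF closed_real_atLeastAtMost _ W_lim[OF t, of i]])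
        (auto simp: B_def)
    then show ?thesis by (simp add: B_def)
  qed
  have g_lim: "(\<lambda>n. g (W n) s i) \<longlonglongrightarrow> g w s i" if s: "s \<in> {0..T}" for s i
  proof -
    \<comment> \<open>The topology on functions is the product topology, so coordinatewise
      convergence suffices for \<open>cont\<close> to apply; no uniformity in the index is
      needed.\<close>
    have "(\<lambda>n. W n s) \<longlonglongrightarrow> w s"
      unfolding limitin_canonical_iff[symmetric] euclidean_product_topology[symmetric]
      by (simp add: limitin_componentwise W_lim[OF s])
    then have "(\<lambda>n. H (W n s) i) \<longlonglongrightarrow> H (w s) i"
      using W_box[OF s] by (intro continuous_on_tendsto_compose[OF cont _ w_box[OF s]]) auto
    then show ?thesis unfolding g_def by (intro tendsto_intros W_lim s)
  qed
  \<comment> \<open>Dominated convergence supplies integrability of the limit integrand along with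
    convergence of the integrals, although \<open>w\<close> is not yet known to be continuous in
    time.\<close>
  have dom: "(\<lambda>s. g w s i) integrable_on {0..t}"
    "(\<lambda>n. integral {0..t} (\<lambda>s. g (W n) s i)) \<longlonglongrightarrow> integral {0..t} (\<lambda>s. g w s i)"
    if t: "t \<in> {0..T}" for t i
  proof -
    have "(\<lambda>s. exp (D * s) * (D * M + K)) integrable_on {0..t}"
      by (intro integrable_continuous_real continuous_intros)
    moreover have "norm (g (W n) s i) \<le> exp (D * s) * (D * M + K)" if "s \<in> {0..t}" for n s
      using g_bounds[of "W n" s i] W_box[of s n] that t by auto
    moreover have "(\<lambda>n. g (W n) s i) \<longlonglongrightarrow> g w s i" if "s \<in> {0..t}" for s
      using that t by (intro g_lim) auto
    ultimately show "(\<lambda>s. g w s i) integrable_on {0..t}"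
      "(\<lambda>n. integral {0..t} (\<lambda>s. g (W n) s i)) \<longlonglongrightarrow> integral {0..t} (\<lambda>s. g w s i)"
      using dominated_convergence[of "\<lambda>n s. g (W n) s i" "{0..t}"
          "\<lambda>s. exp (D * s) * (D * M + K)" "\<lambda>s. g w s i"] gW_int[OF t] by blast+
  qed
  have fixpoint: "w t i = F w t i" if t: "t \<in> {0..T}" for t i
  proof (rule LIMSEQ_unique)
    show "(\<lambda>n. W (Suc n) t i) \<longlonglongrightarrow> w t i" using W_lim[OF t] by (rule LIMSEQ_Suc)
    show "(\<lambda>n. W (Suc n) t i) \<longlonglongrightarrow> F w t i"
      unfolding W_Suc F_def by (intro tendsto_intros dom t)
  qed
  \<comment> \<open>Bootstrap: integrability makes \<open>F w = w\<close> continuous, which makes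
    the integrand continuous, so that the fundamental theorem of calculus gives the
    derivative.\<close>
  have w_cont: "continuous_on {0..T} w"
  proof -
    have "continuous_on {0..T} (F w)" using nonneg by (intro F_cont dom) auto
    moreover have "w t = F w t" if "t \<in> {0..T}" for t using fixpoint[OF that] by blast
    ultimately show ?thesis by (metis (no_types, lifting) continuous_on_cong)
  qed
  have deriv: "((\<lambda>s. w s i) has_real_derivative H (w t) i) (at t within {0..T})"
    if t: "t \<in> {0..T}" for t i
  proof -
    have 1: "((\<lambda>t. integral {0..t} (\<lambda>s. g w s i)) has_real_derivative g w t i) (at t within {0..T})"
      using integral_has_real_derivative[OF g_cont[OF w_cont w_box] t] .
    have "((\<lambda>t. F w t i) has_real_derivative
       exp (- (D * t)) * g w t i - D * F w t i) (at t within {0..T})"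
      unfolding F_def by (rule derivative_eq_intros 1 refl | simp)+
    moreover have "exp (- (D * t)) * g w t i - D * F w t i = H (w t) i"
      using fixpoint[OF t, of i] by (simp add: g_def exp_minus field_simps)
    ultimately have "((\<lambda>t. F w t i) has_real_derivative H (w t) i) (at t within {0..T})" by simp
    then show ?thesis
      by (rule has_field_derivative_transform_within[OF _ zero_less_one t]) (simp add: fixpoint)
  qed
  show thesis
  proof (rule that[of w])
    show "w t i \<in> {0..M}" if "t \<in> {0..T}" for t i using w_box[OF that] by (simp add: B_def)
    show "w 0 i = w0 i" for i using fixpoint[of 0 i] nonneg by (simp add: F_def)
    \<comment> \<open>Mean value inequality with the bound \<open>K\<close> on \<open>H\<close>,
      which is the same for all indices.\<close>
    show "\<bar>w s i - w t i\<bar> \<le> K * \<bar>s - t\<bar>" if "s \<in> {0..T}" "t \<in> {0..T}" for s t i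
      using field_differentiable_bound[of "{0..T}" "\<lambda>s. w s i" "\<lambda>t. H (w t) i" K s t]
        deriv bound[OF w_box] that
      by simp
    show "((\<lambda>s. w s i) has_real_derivative H (w t) i) (at t within {0..T})" if "t \<in> {0..T}" for t i
      using deriv[OF that] .
  qed
qed

text \<open>Since \<open>K\<close> does not depend on the vertex, the supremum over vertices obeys
  the same Lipschitz bound. This turns pointwise estimates into continuity in the sup norm.\<close>

lemma lipschitz_in_C_ell_infinity:
  fixes u :: "real \<Rightarrow> 'v \<Rightarrow> real"
  assumes bnd: "\<And>t x. t \<in> {0..T} \<Longrightarrow> u t x \<in> {0..M}"
    and lip: "\<And>s t x. \<lbrakk>s \<in> {0..T}; t \<in> {0..T}\<rbrakk> \<Longrightarrow> \<bar>u s x - u t x\<bar> \<le> K * \<bar>s - t\<bar>"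
  shows "u \<in> C_ell_infinity T"
proof -
  have space: "u t \<in> mspace ell_infinity" if "t \<in> {0..T}" for t
  proof -
    have "bounded (range (u t))"
      using bnd[OF that] by (intro bounded_subset[OF bounded_closed_interval[of 0 M]]) auto
    then show ?thesis by (simp add: ell_infinity_def Met_TC.fspace_def)
  qed
  have "mdist ell_infinity (u s) (u t) \<le> K * dist s t" if "s \<in> {0..T}" "t \<in> {0..T}" for s t
  proof -
    have "(SUP x. dist (u s x) (u t x)) \<le> K * dist s t"
      using lip[OF that] by (intro cSUP_least) (auto simp: dist_real_def)
    then show ?thesis
      using space that by (simp add: ell_infinity_def Met_TC.fdist_def)
  qed
  with space have "Lipschitz_continuous_map (submetric euclidean_metric {0..T}) ell_infinity u"
    unfolding Lipschitz_continuous_map_def by (auto intro!: exI[of _ K])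
  from Lipschitz_continuous_imp_continuous_map[OF this] show ?thesis
    by (simp add: C_ell_infinity_def mtopology_of_submetric)
qed

lemma D_mu_bound:
  assumes "D_mu adj \<omega> \<mu> < \<infinity>"
  obtains D where "\<And>x. 1 / \<mu> x * (\<Sum>y | adj x y. \<omega> x y) \<le> D"
proof -
  obtain D where "D_mu adj \<omega> \<mu> \<le> ereal D"
    using assms by (metis ereal_dense2 less_imp_le)
  then have "1 / \<mu> x * (\<Sum>y | adj x y. \<omega> x y) \<le> D" for x
    unfolding D_mu_def SUP_le_iff by simp
  then show thesis by (rule that)
qed

section \<open>Order and size estimates for the graph Laplacian\<close>

context weighted_graph
begin

lemma laplacian_eq:
  "laplacian adj \<omega> \<mu> f x =
     1 / \<mu> x * (\<Sum>y | adj x y. \<omega> x y * f y) - 1 / \<mu> x * (\<Sum>y | adj x y. \<omega> x y) * f x"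
  by (simp add: laplacian_def right_diff_distrib sum_subtractf sum_distrib_right)

text \<open>The values at neighbours enter with nonnegative weights; only the value at
  \<open>x\<close> has a negative coefficient, and adding \<open>D\<close> compensates for
  it.\<close>

lemma laplacian_quasimono:
  assumes D: "1 / \<mu> x * (\<Sum>y | adj x y. \<omega> x y) \<le> D" and "f \<le> g"
  shows "D * f x + laplacian adj \<omega> \<mu> f x \<le> D * g x + laplacian adj \<omega> \<mu> g x"
proof -
  define d where "d = 1 / \<mu> x * (\<Sum>y | adj x y. \<omega> x y)"
  have "1 / \<mu> x * (\<Sum>y | adj x y. \<omega> x y * f y) \<le> 1 / \<mu> x * (\<Sum>y | adj x y. \<omega> x y * g y)"
    using assms measure_pos[of x] weight_nonneg
    by (intro mult_left_mono sum_mono) (auto simp: le_fun_def less_imp_le)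
  moreover have "(D - d) * f x \<le> (D - d) * g x"
    using assms by (intro mult_left_mono) (auto simp: le_fun_def d_def)
  ultimately show ?thesis
    unfolding laplacian_eq d_def[symmetric] by (simp add: algebra_simps)
qed

text \<open>Two values in \<open>{0..M}\<close> differ by at most \<open>M\<close>, and the total
  weight at \<open>x\<close> divided by \<open>\<mu> x\<close> is at most \<open>D\<close>.\<close>

lemma abs_laplacian_le:
  assumes D: "1 / \<mu> x * (\<Sum>y | adj x y. \<omega> x y) \<le> D" and f: "\<And>y. f y \<in> {0..M}"
  shows "\<bar>laplacian adj \<omega> \<mu> f x\<bar> \<le> D * M"
proof -
  have M: "0 \<le> M" using f[of x] by simp
  have "\<bar>\<Sum>y | adj x y. \<omega> x y * (f y - f x)\<bar> \<le> (\<Sum>y | adj x y. \<omega> x y * M)"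
  proof (rule order_trans[OF sum_abs sum_mono])
    fix y
    have "\<bar>f y - f x\<bar> \<le> M" using f[of x] f[of y] by auto
    then show "\<bar>\<omega> x y * (f y - f x)\<bar> \<le> \<omega> x y * M"
      using weight_nonneg[of x y] by (simp add: abs_mult mult_left_mono)
  qed
  then have "\<bar>laplacian adj \<omega> \<mu> f x\<bar> \<le> 1 / \<mu> x * (\<Sum>y | adj x y. \<omega> x y * M)"
    using measure_pos[of x] by (simp add: laplacian_def abs_mult divide_right_mono)
  also have "\<dots> = (1 / \<mu> x * (\<Sum>y | adj x y. \<omega> x y)) * M"
    by (simp add: sum_distrib_right)
  also have "\<dots> \<le> D * M" by (rule mult_right_mono[OF D M])
  finally show ?thesis .
qed

end

theorem theorem2p4:
  fixes adj :: "'v \<Rightarrow> 'v \<Rightarrow> bool"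
    and \<omega> :: "'v \<Rightarrow> 'v \<Rightarrow> real"
    and \<mu> :: "'v \<Rightarrow> real"
    and p q :: real
    and u0 v0 :: "'v \<Rightarrow> real"
  assumes "weighted_graph adj \<omega> \<mu>"
    and "mu_min \<mu> > 0"
    and "D_mu adj \<omega> \<mu> < \<infinity>"
    and "p > 0" and "q > 0" and "p * q > 1"
    and "\<And>x. u0 x \<ge> 0" and "bounded (range u0)"
    and "\<And>x. v0 x \<ge> 0" and "bounded (range v0)"
  shows "\<exists>T>0. \<exists>u v. is_solution adj \<omega> \<mu> p q u0 v0 T u v \<and>
           (\<forall>t\<in>{0..T}. \<forall>x. u t x \<ge> 0 \<and> v t x \<ge> 0)"
proof -
  interpret weighted_graph adj \<omega> \<mu> by fact
  obtain D where D: "\<And>x. 1 / \<mu> x * (\<Sum>y | adj x y. \<omega> x y) \<le> D"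
    using D_mu_bound[OF assms(3)] by blast
  have D0: "0 \<le> D"
    using weight_nonneg measure_pos
    by (intro order_trans[OF _ D]) (auto intro!: divide_nonneg_pos sum_nonneg)
  obtain a b where ab: "\<And>x. \<bar>u0 x\<bar> \<le> a" "\<And>x. \<bar>v0 x\<bar> \<le> b"
    using assms(8,10) unfolding bounded_iff by auto
  \<comment> \<open>The summand 1 leaves room for growth above the initial data; \<open>T\<close>
    below is chosen so that the growth \<open>T * (D * M + K)\<close> stays within it.\<close>
  define M where "M = max a b + 1"
  have le_M: "u0 x + 1 \<le> M" "v0 x + 1 \<le> M" for x
    using ab[of x] by (auto simp: M_def)
  have M0: "0 \<le> M" using le_M(1) assms(7) by (meson add_nonneg_nonneg order_trans zero_le_one)
  \<comment> \<open>Both powers are included so that one constant bounds both equations.\<close>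
  define K where "K = D * M + M powr p + M powr q"
  have K0: "0 \<le> K" using D0 M0 by (simp add: K_def)
  define T where "T = 1 / (D * M + K + 1)"
  have T: "0 < T" "T * (D * M + K) \<le> 1"
    using D0 M0 K0 by (auto simp: T_def divide_simps add_nonneg_pos)

  \<comment> \<open>The pair becomes a single function on two copies of the vertex set,
    \<open>Inl\<close> carrying \<open>u\<close> and \<open>Inr\<close> carrying \<open>v\<close>.
    The coupling is increasing, so the system is quasimonotone.\<close>
  define H :: "('v + 'v \<Rightarrow> real) \<Rightarrow> 'v + 'v \<Rightarrow> real" where
    "H w = case_sum
       (\<lambda>x. laplacian adj \<omega> \<mu> (w \<circ> Inl) x + w (Inr x) powr p)
       (\<lambda>x. laplacian adj \<omega> \<mu> (w \<circ> Inr) x + w (Inl x) powr q)" for w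
  obtain w where w: "\<And>t i. t \<in> {0..T} \<Longrightarrow> w t i \<in> {0..M}"
    "\<And>i. w 0 i = case_sum u0 v0 i"
    "\<And>t i. t \<in> {0..T} \<Longrightarrow> ((\<lambda>s. w s i) has_real_derivative H (w t) i) (at t within {0..T})"
    "\<And>s t i. \<lbrakk>s \<in> {0..T}; t \<in> {0..T}\<rbrakk> \<Longrightarrow> \<bar>w s i - w t i\<bar> \<le> K * \<bar>s - t\<bar>"
  proof (rule quasimonotone_system_solution[of M H D K T "case_sum u0 v0"])
    fix i
    show "continuous_on {w. \<forall>j. w j \<in> {0..M}} (\<lambda>w. H w i)"
    proof (cases i)
      case (Inl x)
      \<comment> \<open>Only the coordinates at \<open>x\<close> and its neighbours in one copy and
        at \<open>x\<close> in the other occur. Positivity of the exponent keeps the power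
        continuous at 0.\<close>
      show ?thesis
        unfolding Inl H_def laplacian_def sum.case o_def
        using assms(4) by (intro continuous_intros continuous_on_powr'
            continuous_on_subset[OF continuous_on_product_coordinates]) auto
    next
      case (Inr x)
      show ?thesis
        unfolding Inr H_def laplacian_def sum.case o_def
        using assms(5) by (intro continuous_intros continuous_on_powr'
            continuous_on_subset[OF continuous_on_product_coordinates]) auto
    qed
    show "0 \<le> H (\<lambda>_. 0) i" by (cases i) (simp_all add: H_def laplacian_def)
    show "0 \<le> case_sum u0 v0 i" using assms(7,9) by (cases i) auto
    show "case_sum u0 v0 i + T * (D * M + K) \<le> M"
    proof (cases i)
      case (Inl x)
      show ?thesis using le_M(1)[of x] T(2) unfolding Inl sum.case by linarith
    next
      case (Inr x)
      show ?thesis using le_M(2)[of x] T(2) unfolding Inr sum.case by linarith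
    qed
  next
    fix w w' :: "'v + 'v \<Rightarrow> real" and i
    assume w: "w \<in> {w. \<forall>j. w j \<in> {0..M}}" and "w' \<in> {w. \<forall>j. w j \<in> {0..M}}" and le: "w \<le> w'"
    have "w \<circ> Inl \<le> w' \<circ> Inl" "w \<circ> Inr \<le> w' \<circ> Inr" using le by (auto simp: le_fun_def)
    note lap = laplacian_quasimono[OF D this(1)] laplacian_quasimono[OF D this(2)]
    \<comment> \<open>Powers with any positive exponent increase on nonnegative reals, also for
      exponents below 1, where they are not Lipschitz at 0.\<close>
    have pw: "w j powr r \<le> w' j powr r" if "0 < r" for j r
      using w le that by (intro powr_mono2) (auto simp: le_fun_def)
    show "D * w i + H w i \<le> D * w' i + H w' i"
    proof (cases i)
      case (Inl x)
      show ?thesis using lap(1)[of x] pw[OF assms(4), of "Inr x"] by (simp add: Inl H_def)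
    next
      case (Inr x)
      show ?thesis using lap(2)[of x] pw[OF assms(5), of "Inl x"] by (simp add: Inr H_def)
    qed
  next
    fix w :: "'v + 'v \<Rightarrow> real" and i
    assume w: "w \<in> {w. \<forall>j. w j \<in> {0..M}}"
    then have lap: "\<bar>laplacian adj \<omega> \<mu> (w \<circ> Inl) x\<bar> \<le> D * M"
        "\<bar>laplacian adj \<omega> \<mu> (w \<circ> Inr) x\<bar> \<le> D * M" for x
      by (auto intro!: abs_laplacian_le D)
    have pw: "w j powr r \<le> M powr r" if "0 < r" for j r
      using w that by (intro powr_mono2) auto
    have nn: "0 \<le> w j powr r" "0 \<le> M powr r" for j r by simp_all
    show "\<bar>H w i\<bar> \<le> K"
    proof (cases i)
      case (Inl x)
      show ?thesis
        using lap(1)[of x] pw[OF assms(4), of "Inr x"] nn(1)[of "Inr x" p] nn(2)[of q]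
        unfolding Inl H_def K_def sum.case by linarith
    next
      case (Inr x)
      show ?thesis
        using lap(2)[of x] pw[OF assms(5), of "Inl x"] nn(1)[of "Inl x" q] nn(2)[of p]
        unfolding Inr H_def K_def sum.case by linarith
    qed
  qed (use D0 M0 K0 T in auto)
  define u v where "u t = w t \<circ> Inl" and "v t = w t \<circ> Inr" for t
  have "u \<in> C_ell_infinity T" "v \<in> C_ell_infinity T"
    unfolding u_def v_def
    by (rule lipschitz_in_C_ell_infinity[of T _ M K]; simp only: o_def w(1,4))+
  moreover have "((\<lambda>s. u s x) has_real_derivative laplacian adj \<omega> \<mu> (u t) x + v t x powr p)
      (at t within {0..T})"
    "((\<lambda>s. v s x) has_real_derivative laplacian adj \<omega> \<mu> (v t) x + u t x powr q)
      (at t within {0..T})" if "t \<in> {0..T}" for t x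
    using w(3)[OF that, of "Inl x"] w(3)[OF that, of "Inr x"]
    by (simp_all add: H_def u_def v_def)
  ultimately have "is_solution adj \<omega> \<mu> p q u0 v0 T u v"
    by (simp add: is_solution_def u_def v_def w(2))
  moreover have "u t x \<ge> 0" "v t x \<ge> 0" if "t \<in> {0..T}" for t x
    using w(1)[OF that] by (auto simp: u_def v_def)
  ultimately show ?thesis using T(1) by blast
qed

end
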